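(* Let $k\ge 1$ be an integer and let $L_n$ be a link diagram with $n$ crossings. The number of non-null states for computing the regular isotopy invariant $\eta_k(ss(L_n))$ is $$\sum_{\ell=0}^{k}\binom{n}{\ell}2^{\ell}\quad\text{if } k\le n,\qquad\text{and}\qquad 3^n\quad\text{if } k>n.$$
   Context: The faces of the diagram are 2-colored (shaded/white) in checkerboard fashion, and each crossing is of one of two types: type $X1$ if the region swept by rotating the overpass counterclockwise to the underpass is shaded, and type $X2$ otherwise. Let $A,B,F,X,Y,Z,M,o$ be independent commuting variables. Let $a,b,c,d$ be the four edge-ends at a crossing in counterclockwise cyclic order, with $a,c$ the ends of the underpass, and let $\mathrm{con}[xy]$ denote an arc joining $x$ and $y$. Each crossing is expanded as a sum of three terms: $$X1[a,b,c,d]\to MA\,\mathrm{con}[ab]\mathrm{con}[cd]+MB\,\mathrm{con}[ad]\mathrm{con}[bc]+F\,\mathrm{con}[ac]\mathrm{con}[bd],$$ $$X2[a,b,c,d]\to MX\,\mathrm{con}[ab]\mathrm{con}[cd]+MY\,\mathrm{con}[ad]\mathrm{con}[bc]+Z\,\mathrm{con}[ac]\mathrm{con}[bd].$$ A state is a choice, at every crossing, of one of the three terms of its expansion. The weight of a state is the product of the coefficients chosen, times $o^m$, where $m$ is the number of closed polygons obtained by joining up the chosen arcs. The VSE-state sum $ss(L_n)$ is the sum of the weights of all states. The invariant $\eta_k(ss(L_n))$ is the normal form of $ss(L_n)$ modulo an ideal containing $M^{k+1}$, so one declares $M^{k+1}=0$. A state is non-null (at level $k$) if its weight does not vanish under $M^{k+1}=0$,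 i.e. its weight is not divisible by $M^{k+1}$. *)

theory Defs
  imports Complex_Main "HOL-Library.FuncSet" "HOL-Library.Poly_Mapping"
begin

(* The four edge-ends at a crossing, in counterclockwise order; Ea and Ec are the
   ends of the underpass. *)
datatype edge_end = Ea | Eb | Ec | Ed

fun cw :: "edge_end \<Rightarrow> edge_end" where
  "cw Ea = Ed" | "cw Eb = Ea" | "cw Ec = Eb" | "cw Ed = Ec"

(* Planar diagrams as combinatorial maps. "joined" is the involution matching the two
   ends of every edge; "left_of x" is the region on the left of the edge-end x looking
   away from its crossing, i.e. the region in the corner between x and the next edge-end
   counterclockwise. "circles" are the components without crossings, each with the
   regions on its two sides. *)
record ('c, 'l, 'r) diagram =
  crossings :: "'c set"
  joined :: "'c \<times> edge_end \<Rightarrow> 'c \<times> edge_end"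
  circles :: "'l set"
  regions :: "'r set"
  left_of :: "'c \<times> edge_end \<Rightarrow> 'r"
  circle_sides :: "'l \<Rightarrow> 'r \<times> 'r"

definition edge_ends :: "('c, 'l, 'r, 'z) diagram_scheme \<Rightarrow> ('c \<times> edge_end) set" where
  "edge_ends D = crossings D \<times> UNIV"

definition edges :: "('c, 'l, 'r, 'z) diagram_scheme \<Rightarrow> ('c \<times> edge_end) set set" where
  "edges D = (\<lambda>x. {x, joined D x}) ` edge_ends D"

definition same_component ::
  "('c, 'l, 'r, 'z) diagram_scheme \<Rightarrow> (('c \<times> edge_end) \<times> ('c \<times> edge_end)) set" where
  "same_component D =
     {(x, y). x \<in> edge_ends D \<and> y \<in> edge_ends D \<and> (fst x = fst y \<or> y = joined D x)}\<^sup>*"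

(* Connected components of the underlying planar graph (not of the link). *)
definition num_components :: "('c, 'l, 'r, 'z) diagram_scheme \<Rightarrow> nat" where
  "num_components D = card (edge_ends D // same_component D) + card (circles D)"

definition adjacent_regions :: "('c, 'l, 'r, 'z) diagram_scheme \<Rightarrow> ('r \<times> 'r) set" where
  "adjacent_regions D =
     (\<lambda>x. (left_of D x, left_of D (joined D x))) ` edge_ends D \<union> circle_sides D ` circles D"

(* Going along an edge to its other end joined D x and turning clockwise there keeps the
   same region on the left. The last two conditions say that the ambient surface is
   connected and has genus 0: Euler's formula V - E + R = 1 + C, a crossingless circle
   contributing 0 to V - E and 1 to C; the regions of a split diagram need not be discs. *)
definition link_diagram :: "('c, 'l, 'r, 'z) diagram_scheme \<Rightarrow> bool" where
  "link_diagram D \<longleftrightarrow>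
     finite (crossings D) \<and> finite (circles D) \<and> finite (regions D) \<and>
     (\<forall>x \<in> edge_ends D.
        joined D x \<in> edge_ends D \<and> joined D x \<noteq> x \<and> joined D (joined D x) = x) \<and>
     (\<forall>x \<in> edge_ends D. left_of D x \<in> regions D) \<and>
     (\<forall>c \<in> circles D. circle_sides D c \<in> regions D \<times> regions D) \<and>
     (\<forall>x \<in> edge_ends D. left_of D (apsnd cw (joined D x)) = left_of D x) \<and>
     (\<forall>r \<in> regions D. \<forall>s \<in> regions D.
        (r, s) \<in> (adjacent_regions D \<union> (adjacent_regions D)\<inverse>)\<^sup>*) \<and>
     card (crossings D) + card (regions D) = card (edges D) + 1 + num_components D"

(* S is the set of shaded regions. *)
definition checkerboard :: "('c, 'l, 'r, 'z) diagram_scheme \<Rightarrow> 'r set \<Rightarrow> bool" where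
  "checkerboard D S \<longleftrightarrow>
     S \<subseteq> regions D \<and> (\<forall>(r, s) \<in> adjacent_regions D. r \<in> S \<longleftrightarrow> s \<notin> S)"

datatype crossing_type = X1 | X2

(* Rotating the overpass bd counterclockwise to the underpass sweeps the corners from b
   to c and from d to a; in a checkerboard coloring these have the same color. *)
definition crossing_type :: "('c, 'l, 'r, 'z) diagram_scheme \<Rightarrow> 'r set \<Rightarrow> 'c \<Rightarrow> crossing_type" where
  "crossing_type D S c =
     (if left_of D (c, Eb) \<in> S \<and> left_of D (c, Ed) \<in> S then X1 else X2)"

datatype indeterminate = VarA | VarB | VarF | VarX | VarY | VarZ | VarM | Varo

(* Integer polynomials: finitely supported coefficient functions on exponent vectors. *)
type_synonym vse_poly = "(indeterminate \<Rightarrow>\<^sub>0 nat) \<Rightarrow>\<^sub>0 int"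

definition var :: "indeterminate \<Rightarrow> vse_poly" where
  "var v = Poly_Mapping.single (Poly_Mapping.single v 1) 1"

(* con[ab]con[cd], con[ad]con[bc], con[ac]con[bd] *)
datatype expansion_term = Con_ab_cd | Con_ad_bc | Con_ac_bd

fun con_arc :: "expansion_term \<Rightarrow> edge_end \<Rightarrow> edge_end" where
  "con_arc Con_ab_cd Ea = Eb" | "con_arc Con_ab_cd Eb = Ea"
| "con_arc Con_ab_cd Ec = Ed" | "con_arc Con_ab_cd Ed = Ec"
| "con_arc Con_ad_bc Ea = Ed" | "con_arc Con_ad_bc Ed = Ea"
| "con_arc Con_ad_bc Eb = Ec" | "con_arc Con_ad_bc Ec = Eb"
| "con_arc Con_ac_bd Ea = Ec" | "con_arc Con_ac_bd Ec = Ea"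
| "con_arc Con_ac_bd Eb = Ed" | "con_arc Con_ac_bd Ed = Eb"

fun coefficient :: "crossing_type \<Rightarrow> expansion_term \<Rightarrow> vse_poly" where
  "coefficient X1 Con_ab_cd = var VarM * var VarA"
| "coefficient X1 Con_ad_bc = var VarM * var VarB"
| "coefficient X1 Con_ac_bd = var VarF"
| "coefficient X2 Con_ab_cd = var VarM * var VarX"
| "coefficient X2 Con_ad_bc = var VarM * var VarY"
| "coefficient X2 Con_ac_bd = var VarZ"

definition states :: "('c, 'l, 'r, 'z) diagram_scheme \<Rightarrow> ('c \<Rightarrow> expansion_term) set" where
  "states D = crossings D \<rightarrow>\<^sub>E UNIV"

definition same_polygon ::
  "('c, 'l, 'r, 'z) diagram_scheme \<Rightarrow> ('c \<Rightarrow> expansion_term)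
     \<Rightarrow> (('c \<times> edge_end) \<times> ('c \<times> edge_end)) set" where
  "same_polygon D s =
     {(x, y). x \<in> edge_ends D \<and> y \<in> edge_ends D \<and>
        (y = joined D x \<or> y = (fst x, con_arc (s (fst x)) (snd x)))}\<^sup>*"

definition num_polygons ::
  "('c, 'l, 'r, 'z) diagram_scheme \<Rightarrow> ('c \<Rightarrow> expansion_term) \<Rightarrow> nat" where
  "num_polygons D s = card (edge_ends D // same_polygon D s) + card (circles D)"

definition weight ::
  "('c, 'l, 'r, 'z) diagram_scheme \<Rightarrow> 'r set \<Rightarrow> ('c \<Rightarrow> expansion_term) \<Rightarrow> vse_poly" where
  "weight D S s =
     (\<Prod>c \<in> crossings D. coefficient (crossing_type D S c) (s c)) * var Varo ^ num_polygons D s"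

definition state_sum :: "('c, 'l, 'r, 'z) diagram_scheme \<Rightarrow> 'r set \<Rightarrow> vse_poly" where
  "state_sum D S = (\<Sum>s \<in> states D. weight D S s)"

definition non_null ::
  "nat \<Rightarrow> ('c, 'l, 'r, 'z) diagram_scheme \<Rightarrow> 'r set \<Rightarrow> ('c \<Rightarrow> expansion_term) \<Rightarrow> bool" where
  "non_null k D S s \<longleftrightarrow> \<not> var VarM ^ (k + 1) dvd weight D S s"

end

(* Every weight is a single monomial, whose exponent at M is the number of crossings at
   which the state does not choose con[ac]con[bd]. So a state is non-null exactly when this
   number is at most k, and for each l there are (n choose l) 2^l states for which it is l:
   choose the l crossings, then one of the two other terms at each of them. *)
theory Submission
  imports Defs
begin

lemma prod_single:
  "finite A \<Longrightarrow> (\<Prod>x\<in>A. Poly_Mapping.single (e x) (c x)) =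
     Poly_Mapping.single (\<Sum>x\<in>A. e x) (\<Prod>x\<in>A. c x)"
  for c :: "_ \<Rightarrow> 'b::comm_semiring_1" and e :: "_ \<Rightarrow> 'a::comm_monoid_add"
  by (induction A rule: finite_induct) (simp_all add: mult_single)

lemma var_power: "var v ^ m = Poly_Mapping.single (Poly_Mapping.single v m) 1"
  by (induction m) (simp_all add: var_def mult_single single_add[symmetric])

text \<open>Every exponent vector occurring in a multiple of \<open>var v ^ m\<close> has the form
  \<open>single v m + b\<close>, so it is at least \<open>m\<close> at \<open>v\<close>; conversely,
  the remaining exponents give the cofactor.\<close>

lemma var_power_dvd_monomial:
  "var v ^ m dvd Poly_Mapping.single e 1 \<longleftrightarrow> m \<le> Poly_Mapping.lookup e v"
proof
  assume "var v ^ m dvd Poly_Mapping.single e 1"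
  then obtain q where
    "Poly_Mapping.single e (1::int) = Poly_Mapping.single (Poly_Mapping.single v m) 1 * q"
    by (auto simp: var_power dvd_def)
  then have "e \<in> Poly_Mapping.keys (Poly_Mapping.single (Poly_Mapping.single v m) (1::int) * q)"
    by (metis in_keys_iff lookup_single_eq one_neq_zero)
  then obtain b where "e = Poly_Mapping.single v m + b"
    using keys_mult[of "Poly_Mapping.single (Poly_Mapping.single v m) (1::int)" q] by auto
  then show "m \<le> Poly_Mapping.lookup e v"
    by (simp add: lookup_add)
next
  assume "m \<le> Poly_Mapping.lookup e v"
  \<comment> \<open>Subtraction of exponent vectors is pointwise and truncated at 0; the assumption
    ensures that nothing is lost at \<open>v\<close>.\<close>
  then have "e = Poly_Mapping.single v m + (e - Poly_Mapping.single v m)"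
    by (intro poly_mapping_eqI) (auto simp: lookup_add lookup_minus lookup_single when_def)
  then have "Poly_Mapping.single e 1 =
      var v ^ m * Poly_Mapping.single (e - Poly_Mapping.single v m) 1"
    by (metis mult_1 mult_single var_power)
  then show "var v ^ m dvd Poly_Mapping.single e 1"
    by (rule dvdI)
qed

text \<open>In both crossing types the factor \<open>M\<close> marks exactly the two smoothings, so
  the exponent at \<open>VarM\<close> can serve as a counter for them.\<close>

lemma coefficient_monomial:
  "\<exists>e. coefficient t c = Poly_Mapping.single e 1 \<and>
    Poly_Mapping.lookup e VarM = (if c = Con_ac_bd then 0 else 1)"
  by (cases "(t, c)" rule: coefficient.cases)
    (auto simp: var_def mult_single lookup_add lookup_single when_def)

text \<open>Exponent vectors add up in the product over the crossings: each smoothed crossing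
  contributes 1 at \<open>VarM\<close>, and the power of \<open>o\<close> contributes nothing
  there.\<close>

lemma non_null_iff:
  assumes "finite (crossings D)"
  shows "non_null k D S s \<longleftrightarrow> card {c \<in> crossings D. s c \<noteq> Con_ac_bd} \<le> k"
proof -
  obtain e where e:
    "\<And>c. coefficient (crossing_type D S c) (s c) = Poly_Mapping.single (e c) 1"
    "\<And>c. Poly_Mapping.lookup (e c) VarM = (if s c = Con_ac_bd then 0 else 1)"
    using choice[of "\<lambda>c e. coefficient (crossing_type D S c) (s c) = Poly_Mapping.single e 1 \<and>
      Poly_Mapping.lookup e VarM = (if s c = Con_ac_bd then 0 else 1)"] coefficient_monomial
    by blast
  let ?e = "(\<Sum>c\<in>crossings D. e c) + Poly_Mapping.single Varo (num_polygons D s)"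
  have "weight D S s = Poly_Mapping.single ?e 1"
    by (simp add: weight_def e(1) prod_single assms var_power mult_single)
  moreover have "Poly_Mapping.lookup ?e VarM = card {c \<in> crossings D. s c \<noteq> Con_ac_bd}"
    using assms by (simp add: lookup_add lookup_sum lookup_single e(2) sum.If_cases
        Collect_conj_eq Collect_neg_eq)
  ultimately show ?thesis
    by (auto simp only: non_null_def var_power_dvd_monomial)
qed

text \<open>Sort the functions by the set \<open>T\<close> of places where the value is not the
  distinguished \<open>b\<close>. There are \<open>card A choose l\<close> such sets, and each
  leaves \<open>card B - 1\<close> values free at each of its \<open>l\<close> places.\<close>

lemma card_PiE_card_neq:
  assumes "finite A" "finite B" "b \<in> B"
  shows "card {f \<in> A \<rightarrow>\<^sub>E B. card {x \<in> A. f x \<noteq> b} = l} = (card A choose l) * (card B - 1) ^ l"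
proof -
  let ?F = "\<lambda>T. \<Pi>\<^sub>E x\<in>A. if x \<in> T then B - {b} else {b}"
  let ?K = "{T. T \<subseteq> A \<and> card T = l}"
  \<comment> \<open>The block \<open>?F T\<close> forbids \<open>b\<close> on \<open>T\<close> and
    forces it on the rest of \<open>A\<close>, so \<open>T\<close> can be read off from any member.
    This gives both the size condition and the disjointness of the blocks.\<close>
  have support: "{x \<in> A. f x \<noteq> b} = T" if "f \<in> ?F T" "T \<subseteq> A" for f T
    using that by (auto simp: PiE_iff split: if_splits)
  have "{f \<in> A \<rightarrow>\<^sub>E B. card {x \<in> A. f x \<noteq> b} = l} = (\<Union>T\<in>?K. ?F T)"
  proof (intro equalityI subsetI)
    fix f assume f: "f \<in> {f \<in> A \<rightarrow>\<^sub>E B. card {x \<in> A. f x \<noteq> b} = l}"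
    then have "f \<in> ?F {x \<in> A. f x \<noteq> b}"
      by (auto simp: PiE_iff)
    with f show "f \<in> (\<Union>T\<in>?K. ?F T)"
      by (intro UN_I[of "{x \<in> A. f x \<noteq> b}"]) auto
  next
    fix f assume "f \<in> (\<Union>T\<in>?K. ?F T)"
    then obtain T where T: "T \<subseteq> A" "card T = l" "f \<in> ?F T"
      by (elim UN_E CollectE conjE)
    then have "f \<in> A \<rightarrow>\<^sub>E B"
      using assms(3) by (auto simp: PiE_iff split: if_splits)
    with T support[OF T(3,1)] show "f \<in> {f \<in> A \<rightarrow>\<^sub>E B. card {x \<in> A. f x \<noteq> b} = l}"
      by simp
  qed
  moreover have "card (\<Union>T\<in>?K. ?F T) = (\<Sum>T\<in>?K. card (?F T))"
  proof (rule card_UN_disjoint)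
    show "\<forall>T\<in>?K. finite (?F T)"
      using assms by (auto intro!: finite_PiE)
    show "\<forall>T\<in>?K. \<forall>U\<in>?K. T \<noteq> U \<longrightarrow> ?F T \<inter> ?F U = {}"
    proof (intro ballI impI equals0I)
      fix T U f assume "T \<in> ?K" "U \<in> ?K" "T \<noteq> U" "f \<in> ?F T \<inter> ?F U"
      then show False
        using support[of f T] support[of f U] by simp
    qed
  qed (use assms in simp)
  moreover have "card (?F T) = (card B - 1) ^ l" if "T \<in> ?K" for T
  proof -
    \<comment> \<open>Since \<open>b\<close> lies in \<open>B\<close>, removing it leaves
      \<open>card B - 1\<close> choices on \<open>T\<close>; each place outside \<open>T\<close>
      contributes a factor 1.\<close>
    have "card (?F T) = (\<Prod>x\<in>A. if x \<in> T then card B - 1 else 1)"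
      using assms by (auto simp: card_PiE intro!: prod.cong)
    also have "\<dots> = (card B - 1) ^ l"
      using assms(1) that by (simp add: prod.If_cases Int_absorb1)
    finally show ?thesis .
  qed
  ultimately show ?thesis
    using assms(1) by (simp add: n_subsets)
qed

lemma UNIV_expansion_term: "UNIV = {Con_ab_cd, Con_ad_bc, Con_ac_bd}"
  using expansion_term.exhaust by blast

theorem mainTheorem4:
  fixes L :: "('c, 'l, 'r) diagram" and S :: "'r set" and n k :: nat
  assumes "k \<ge> 1"
    and "link_diagram L"
    and "card (crossings L) = n"
    and "checkerboard L S"
  shows "(k \<le> n \<longrightarrow> card {s \<in> states L. non_null k L S s} = (\<Sum>l = 0..k. (n choose l) * 2 ^ l))
       \<and> (k > n \<longrightarrow> card {s \<in> states L. non_null k L S s} = 3 ^ n)"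
proof -
  let ?C = "crossings L"
  let ?smoothed = "\<lambda>s. card {c \<in> ?C. s c \<noteq> Con_ac_bd}"
  have fin: "finite ?C"
    using assms(2) by (simp add: link_diagram_def)
  have fin_terms: "finite (UNIV :: expansion_term set)" and card_terms: "card (UNIV :: expansion_term set) = 3"
    by (simp_all add: UNIV_expansion_term)
  have fin_states: "finite (states L)"
    using fin fin_terms by (auto simp: states_def intro: finite_PiE)
  \<comment> \<open>The non-null states are sliced by their number of smoothed crossings; the slices
    are disjoint, so their sizes add.\<close>
  have "card {s \<in> states L. non_null k L S s} = card (\<Union>l\<in>{0..k}. {s \<in> states L. ?smoothed s = l})"
    by (rule arg_cong[of _ _ card]) (auto simp: non_null_iff[OF fin])
  also have "\<dots> = (\<Sum>l = 0..k. card {s \<in> states L. ?smoothed s = l})"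
    using fin_states by (intro card_UN_disjoint) auto
  \<comment> \<open>The base 2 is \<open>3 - 1\<close>: the expansion terms other than
    \<open>Con_ac_bd\<close>.\<close>
  also have "\<dots> = (\<Sum>l = 0..k. (n choose l) * 2 ^ l)"
    unfolding states_def
    by (simp add: card_PiE_card_neq[OF fin fin_terms] card_terms assms(3))
  finally have "card {s \<in> states L. non_null k L S s} = (\<Sum>l = 0..k. (n choose l) * 2 ^ l)" .
  moreover have "card {s \<in> states L. non_null k L S s} = 3 ^ n" if "k > n"
  proof -
    \<comment> \<open>At most \<open>n\<close> crossings can be smoothed, and \<open>n < k\<close>,
      so every state is non-null and all \<open>3 ^ n\<close> choices are counted.\<close>
    have "?smoothed s \<le> k" for s
      using card_mono[OF fin, of "{c \<in> ?C. s c \<noteq> Con_ac_bd}"] that assms(3) by auto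
    then show ?thesis
      using fin by (simp add: non_null_iff states_def card_PiE card_terms assms(3))
  qed
  ultimately show ?thesis
    by blast
qed

end
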